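(* Let $\tau,\sigma>0$ be fixed with $\tau(\sigma\|K\|^2+L)<1$. Under the standing assumptions on $X,Y,K,f,f^\delta,H_f,H_{f^\delta},R,G,u^\dagger,v^\dagger$ listed in the context, let $(u^k,v^k)_{k\ge 0}$ be generated by the Condat–Vũ iteration $$u^{k+1}=\operatorname{prox}_{\tau R}\big(u^k-\tau(K^*v^k+G'(u^k))\big),\qquad v^{k+1}=\operatorname{prox}_{\sigma H_{f^\delta}^*}\big(v^k+\sigma K(2u^{k+1}-u^k)\big),$$ with initial values $u^0\in\operatorname{dom}G'$, $v^0\in Y$. Assume that there exist a constant $C>0$ and subgradients $\zeta^\delta\in\partial H_{f^\delta}^*(v^\dagger)$ and $\zeta\in\partial H_f^*(v^\dagger)$ such that $$\forall k\in\mathbb N:\quad \langle \zeta^\delta-\zeta,\,v^\dagger-v^k\rangle\le C\delta\|v^\dagger-v^k\|.$$ Let $\overline u^n=\frac1n\sum_{k=1}^n u^k$, $\overline v^n=\frac1n\sum_{k=1}^n v^k$. Then there exists $\nu>0$ such that for every $n\ge 1$, $$D_{R+G}(\overline u^n,u^\dagger)+D_{H_{f^\delta}^*}(\overline v^n,v^\dagger)\le \frac1n D_B(w^\dagger,w^0)+\frac{C^2}{\nu}\delta^2(n+1)+C\delta\sqrt{\frac{2D_B(w^\dagger,w^0)}{\nu}},$$ where $w^\dagger=(u^\dagger,v^\dagger)$, $w^0=(u^0,v^0)$ and $$B(u,v)=\frac1{2\tau}\|u\|^2+\frac1{2\sigma}\|v\|^2-\langle v,Ku\rangle-G(u).$$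
   Context: Standing assumptions. - $X,Y$ are (real) Hilbert spaces, identified with their duals; $K:X\to Y$ is linear, bounded and ill-posed ("ill-posed" is the qualitative description that direct inversion of $K$ may strongly amplify noise; no further quantitative property is meant). - $f\in Y$ is the exact data, $f^\delta\in Y$ the noisy data, with $\|f-f^\delta\|\le\delta$. - $H_f=i_{\{f\}}$ is the indicator function of $\{f\}$ (zero at $f$, $+\infty$ elsewhere), and $H_{f^\delta}:Y\to\mathbb R\cup\{+\infty\}$ is a general proper, convex, lower semicontinuous function. $H^*$ denotes the Fenchel conjugate. - $R:X\to\mathbb R\cup\{+\infty\}$ is proper, convex and lower semicontinuous. - $G:X\to\mathbb R\cup\{+\infty\}$ is proper, convex, Fréchet differentiable with derivative $G'$, and $L$-smooth: $D_G(u_1,u_2)\le\frac L2\|u_1-u_2\|^2$ for all $u_1,u_2\in\operatorname{int}\operatorname{dom}G$. - There exists $\bar u\in\operatorname{dom}(H_f\circ K)\cap\operatorname{dom}R\cap\operatorname{dom}G$ such that $R+G$ is continuous at $\bar u$. - $u^\dagger\in X$ is a solution of $\inf_{u\in X}\{R(u)+G(u)\}$ subject to $Ku=f$, with $R(u^\dagger),G(u^\dagger)$ finite. - Source condition: $v^\dagger\in Y$ satisfies $-K^*v^\dagger\in\partial(R+G)(u^\dagger)$. Notation. $\operatorname{prox}_{\tau g}(x)=\arg\min_z\{g(z)+\frac1{2\tau}\|z-x\|^2\}$. The Bregman distance of a convex function $g$ with respect to $\xi\in\partial g(y)$ is $D_g(x,y)=g(x)-g(y)-\langle\xi,x-y\rangle$;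 for differentiable $g$, $\xi$ is the gradient at $y$ (in particular $D_B(w^\dagger,w^0)=B(w^\dagger)-B(w^0)-\langle\nabla B(w^0),w^\dagger-w^0\rangle$). In the conclusion, $D_{R+G}(\cdot,u^\dagger)$ is taken with respect to the subgradient $-K^*v^\dagger$, and $D_{H_{f^\delta}^*}(\cdot,v^\dagger)$ with respect to $\zeta^\delta$. *)

theory Defs
  imports "HOL-Analysis.Analysis"
begin

text \<open>
  Extended-valued convex analysis on real Hilbert spaces, i.e. types of sort
  \<open>{real_inner, complete_space}\<close>, for functions into \<open>ereal\<close>.
\<close>

definition edom :: "('a \<Rightarrow> ereal) \<Rightarrow> 'a set" where
  "edom g = {x. g x < \<infinity>}"

definition proper :: "('a \<Rightarrow> ereal) \<Rightarrow> bool" where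
  "proper g \<longleftrightarrow> (\<forall>x. g x \<noteq> -\<infinity>) \<and> edom g \<noteq> {}"

definition econvex :: "('a::real_vector \<Rightarrow> ereal) \<Rightarrow> bool" where
  "econvex g \<longleftrightarrow> (\<forall>x y t. 0 < t \<and> t < 1 \<longrightarrow>
     g ((1 - t) *\<^sub>R x + t *\<^sub>R y) \<le> ereal (1 - t) * g x + ereal t * g y)"

definition lsc :: "('a::topological_space \<Rightarrow> ereal) \<Rightarrow> bool" where
  "lsc g \<longleftrightarrow> (\<forall>x. g x \<le> Liminf (nhds x) g)"

text \<open>The convex-analytic indicator, not the \<open>0/1\<close>-valued one of the library.\<close>

definition convex_indicator :: "'a set \<Rightarrow> 'a \<Rightarrow> ereal" where
  "convex_indicator S x = (if x \<in> S then 0 else \<infinity>)"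

definition fenchel_conjugate :: "('a::real_inner \<Rightarrow> ereal) \<Rightarrow> 'a \<Rightarrow> ereal" where
  "fenchel_conjugate g v = (SUP x. ereal (v \<bullet> x) - g x)"

definition subdifferential :: "('a::real_inner \<Rightarrow> ereal) \<Rightarrow> 'a \<Rightarrow> 'a set" where
  "subdifferential g y = {\<xi>. \<bar>g y\<bar> \<noteq> \<infinity> \<and> (\<forall>x. g y + ereal (\<xi> \<bullet> (x - y)) \<le> g x)}"

text \<open>
  \<open>is_prox \<tau> g x z\<close> is the relation \<open>z = prox\<^bsub>\<tau>g\<^esub>(x)\<close>: the point \<open>z\<close> minimises
  the objective over the whole space.
\<close>

definition is_prox :: "real \<Rightarrow> ('a::real_inner \<Rightarrow> ereal) \<Rightarrow> 'a \<Rightarrow> 'a \<Rightarrow> bool" where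
  "is_prox \<tau> g x z \<longleftrightarrow>
     is_arg_min (\<lambda>z. g z + ereal (1 / (2 * \<tau>) * (norm (z - x))\<^sup>2)) (\<lambda>_. True) z"

text \<open>
  Frechet differentiability of an extended-valued function requires finiteness in a
  neighbourhood; the derivative is identified with an element of the Hilbert space.
\<close>

definition has_gradient :: "('a::real_inner \<Rightarrow> ereal) \<Rightarrow> 'a \<Rightarrow> 'a \<Rightarrow> bool" where
  "has_gradient g x D \<longleftrightarrow>
     (\<forall>\<^sub>F z in nhds x. \<bar>g z\<bar> \<noteq> \<infinity>) \<and> GDERIV (\<lambda>z. real_of_ereal (g z)) x :> D"

definition gradient :: "('a::real_inner \<Rightarrow> ereal) \<Rightarrow> 'a \<Rightarrow> 'a" where
  "gradient g x = (THE D. has_gradient g x D)"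

definition dom_gradient :: "('a::real_inner \<Rightarrow> ereal) \<Rightarrow> 'a set" where
  "dom_gradient g = {x. \<exists>D. has_gradient g x D}"

lemma gradient_eq:
  assumes "has_gradient g x D"
  shows "gradient g x = D"
proof -
  have "D' = D" if "has_gradient g x D'" for D'
  proof -
    have "(\<lambda>h. h \<bullet> D') = (\<lambda>h. h \<bullet> D)"
      using assms that unfolding has_gradient_def gderiv_def
      by (blast intro: has_derivative_unique)
    then show ?thesis
      by (metis inner_commute vector_eq_rdot)
  qed
  with assms show ?thesis
    unfolding gradient_def by blast
qed

definition bregman :: "('a::real_inner \<Rightarrow> ereal) \<Rightarrow> 'a \<Rightarrow> 'a \<Rightarrow> 'a \<Rightarrow> ereal" where
  "bregman g \<xi> x y = g x - g y - ereal (\<xi> \<bullet> (x - y))"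

definition bregman_grad :: "('a::real_inner \<Rightarrow> ereal) \<Rightarrow> 'a \<Rightarrow> 'a \<Rightarrow> ereal" where
  "bregman_grad g x y = bregman g (gradient g y) x y"

text \<open>
  Differentiability of a convex \<open>G\<close> is meant on the interior of its domain, the largest set
  on which it is possible.
\<close>

definition frechet_differentiable :: "('a::real_inner \<Rightarrow> ereal) \<Rightarrow> bool" where
  "frechet_differentiable g \<longleftrightarrow> interior (edom g) \<subseteq> dom_gradient g"

definition L_smooth :: "real \<Rightarrow> ('a::real_inner \<Rightarrow> ereal) \<Rightarrow> bool" where
  "L_smooth L g \<longleftrightarrow> (\<forall>u1\<in>interior (edom g). \<forall>u2\<in>interior (edom g).
     bregman_grad g u1 u2 \<le> ereal (L / 2 * (norm (u1 - u2))\<^sup>2))"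

text \<open>
  \<open>adjoint K\<close> is the Hilbert space adjoint when \<open>K\<close> is bounded linear. The condition
  \<open>u k \<in> dom_gradient G\<close> expresses that the derivative of \<open>G\<close> used in the \<open>k\<close>-th step exists,
  i.e. that the iteration is well defined; for \<open>k = 0\<close> it is the condition on the initial value.
\<close>

definition condat_vu ::
  "real \<Rightarrow> real \<Rightarrow> ('a::real_inner \<Rightarrow> 'b::real_inner) \<Rightarrow> ('a \<Rightarrow> ereal) \<Rightarrow> ('a \<Rightarrow> ereal) \<Rightarrow>
   ('b \<Rightarrow> ereal) \<Rightarrow> (nat \<Rightarrow> 'a) \<Rightarrow> (nat \<Rightarrow> 'b) \<Rightarrow> bool" where
  "condat_vu \<tau> \<sigma> K R G H u v \<longleftrightarrow> (\<forall>k.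
     u k \<in> dom_gradient G \<and>
     is_prox \<tau> R (u k - \<tau> *\<^sub>R (adjoint K (v k) + gradient G (u k))) (u (Suc k)) \<and>
     is_prox \<sigma> (fenchel_conjugate H) (v k + \<sigma> *\<^sub>R K (2 *\<^sub>R u (Suc k) - u k)) (v (Suc k)))"

text \<open>
  \<open>B\<close> is \<open>-\<infinity>\<close> outside the domain of \<open>G\<close>. Its Bregman distance from \<open>w0\<close> to \<open>w\<close> is finite whenever
  \<open>G (fst w)\<close> is finite and \<open>G\<close> is differentiable at \<open>fst w0\<close>.
\<close>

definition condat_vu_B ::
  "real \<Rightarrow> real \<Rightarrow> ('a::real_inner \<Rightarrow> 'b::real_inner) \<Rightarrow> ('a \<Rightarrow> ereal) \<Rightarrow> 'a \<times> 'b \<Rightarrow> ereal" where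
  "condat_vu_B \<tau> \<sigma> K G = (\<lambda>(u, v).
     ereal (1 / (2 * \<tau>) * (norm u)\<^sup>2 + 1 / (2 * \<sigma>) * (norm v)\<^sup>2 - v \<bullet> K u) - G u)"

definition ergodic_mean :: "(nat \<Rightarrow> 'a::real_vector) \<Rightarrow> nat \<Rightarrow> 'a" where
  "ergodic_mean x n = (1 / real n) *\<^sub>R (\<Sum>k=1..n. x k)"

end

theory Submission
  imports Defs
begin

text \<open>
  The Condat--Vu iteration is a Bregman proximal point method for the function \<open>B\<close>: the prox
  inclusions say that \<open>\<nabla>B(w\<^sup>k) - \<nabla>B(w\<^sup>k\<^sup>+\<^sup>1)\<close> is a (monotone) saddle point subgradient at \<open>w\<^sup>k\<^sup>+\<^sup>1\<close>.
  With the three-point identity for \<open>D\<^sub>B\<close> this makes the error at step \<open>k + 1\<close> plus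
  \<open>D\<^sub>B(w\<^sup>\<dagger>, w\<^sup>k\<^sup>+\<^sup>1)\<close> at most \<open>D\<^sub>B(w\<^sup>\<dagger>, w\<^sup>k) + \<langle>\<zeta>\<^sup>\<delta> - \<zeta>, v\<^sup>\<dagger> - v\<^sup>k\<^sup>+\<^sup>1\<rangle>\<close>. The step size
  condition gives \<open>D\<^sub>B(w\<^sup>\<dagger>, w) \<ge> \<nu>/2 \<parallel>v\<^sup>\<dagger> - v\<parallel>\<^sup>2\<close> with \<open>\<nu> = 1/\<sigma> - \<parallel>K\<parallel>\<^sup>2 / (1/\<tau> - L)\<close>, so the
  telescoped estimate is a quadratic recursion for \<open>\<parallel>v\<^sup>\<dagger> - v\<^sup>n\<parallel>\<close>; it yields linear growth in \<open>n\<close>,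
  and Jensen's inequality passes to the ergodic means.
\<close>

section \<open>Hilbert space adjoints via Riesz representation\<close>

text \<open>For small \<open>t\<close> of sign opposite to \<open>a\<close> the linear term wins.
  Since \<open>c\<close> is positive and exceeds \<open>b\<close>, the choice
  \<open>t = - a / c\<close> is small enough.\<close>

lemma vanish_of_parabola_nonneg:
  fixes a b :: real
  assumes "\<And>t. t * a + t\<^sup>2 * b \<ge> 0"
  shows "a = 0"
proof (rule ccontr)
  assume a: "a \<noteq> 0"
  define c where "c = \<bar>b\<bar> + 1"
  have c: "c > 0" "b < c" by (auto simp: c_def)
  have "(- a / c) * a + (- a / c)\<^sup>2 * b = a\<^sup>2 / c * (b / c - 1)"
    using c by (simp add: field_simps power2_eq_square)
  moreover have "a\<^sup>2 / c * (b / c - 1) < 0"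
    using a c by (intro mult_pos_neg) (auto simp: field_simps)
  ultimately show False
    using assms[of "- a / c"] by linarith
qed

text \<open>Direct method: the representing vector is the minimiser of \<open>J\<close>. A
  minimising sequence is Cauchy by the parallelogram identity, and stationarity of \<open>J\<close>
  at its limit is the claim.\<close>

lemma riesz_representation:
  fixes \<phi> :: "'a::{real_inner, complete_space} \<Rightarrow> real"
  assumes \<phi>: "bounded_linear \<phi>"
  obtains z where "\<And>x. \<phi> x = x \<bullet> z"
proof -
  interpret bounded_linear \<phi> by (rule \<phi>)
  define J where "J x = (norm x)\<^sup>2 / 2 - \<phi> x" for x
  define m where "m = Inf (range J)"
  have below: "- ((onorm \<phi>)\<^sup>2 / 2) \<le> J x" for x
  proof -
    have "\<phi> x \<le> onorm \<phi> * norm x"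
      using onorm[OF \<phi>, of x] by simp
    moreover have "(norm x - onorm \<phi>)\<^sup>2 \<ge> 0" by simp
    ultimately show ?thesis
      unfolding J_def power2_diff by (simp add: field_simps)
  qed
  have bdd: "bdd_below (range J)"
    using below by (intro bdd_belowI) auto
  have m_le: "m \<le> J x" for x
    unfolding m_def using bdd by (intro cInf_lower) auto
  have "\<exists>x. J x < m + 1 / real (Suc n)" for n
    using cInf_lessD[of "range J" "m + 1 / real (Suc n)"] by (auto simp: m_def)
  then obtain X where X: "\<And>n. J (X n) < m + 1 / real (Suc n)"
    by metis
  \<comment> \<open>Two near-minimisers are close: by the parallelogram identity their midpoint has
    a value of \<open>J\<close> below the average by \<open>norm (x - y)\<close> squared over 8, yet
    not below \<open>m\<close>.\<close>
  have mid: "(norm (x - y))\<^sup>2 \<le> 4 * (J x - m) + 4 * (J y - m)" for x y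
  proof -
    have "J ((1/2) *\<^sub>R (x + y)) = J x / 2 + J y / 2 - (norm (x - y))\<^sup>2 / 8"
      unfolding J_def power2_norm_eq_inner
      by (simp add: scaleR add inner_simps inner_commute field_simps)
    with m_le[of "(1/2) *\<^sub>R (x + y)"] show ?thesis by (simp add: field_simps)
  qed
  have "Cauchy X"
  proof (rule metric_CauchyI)
    fix e :: real
    assume e: "e > 0"
    then obtain N where N: "8 / e\<^sup>2 < real N"
      using reals_Archimedean2 by blast
    have "dist (X p) (X q) < e" if "p \<ge> N" "q \<ge> N" for p q
    proof -
      have b: "J (X p) - m < e\<^sup>2 / 8" if "p \<ge> N" for p
      proof -
        have "8 / e\<^sup>2 < real (Suc p)" using N that by linarith
        then have "1 / real (Suc p) < e\<^sup>2 / 8"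
          using e by (simp add: field_simps)
        with X[of p] show ?thesis by linarith
      qed
      have "4 * (J (X p) - m) + 4 * (J (X q) - m) < 4 * (e\<^sup>2 / 8) + 4 * (e\<^sup>2 / 8)"
        using b that by (intro add_strict_mono mult_strict_left_mono) auto
      with mid[of "X p" "X q"] have "(norm (X p - X q))\<^sup>2 < e\<^sup>2"
        by simp
      then show ?thesis
        using e by (simp add: dist_norm power2_less_imp_less)
    qed
    then show "\<exists>M. \<forall>p\<ge>M. \<forall>q\<ge>M. dist (X p) (X q) < e" by blast
  qed
  then obtain z where z: "X \<longlonglongrightarrow> z"
    using Cauchy_convergent convergent_def by blast
  have "(\<lambda>n. J (X n)) \<longlonglongrightarrow> J z"
    unfolding J_def by (intro tendsto_intros tendsto z) simp
  moreover have "(\<lambda>n. m + 1 / real (Suc n)) \<longlonglongrightarrow> m + 0"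
    by (intro tendsto_intros LIMSEQ_Suc[OF lim_1_over_n])
  ultimately have Jz: "J z \<le> m"
    using LIMSEQ_le[of "\<lambda>n. J (X n)" "J z" "\<lambda>n. m + 1 / real (Suc n)" "m + 0"] X
    by (auto intro: less_imp_le)
  have "\<phi> h = h \<bullet> z" for h
  proof -
    have "t * (z \<bullet> h - \<phi> h) + t\<^sup>2 * ((norm h)\<^sup>2 / 2) \<ge> 0" for t
    proof -
      have "J (z + t *\<^sub>R h) - J z = t * (z \<bullet> h - \<phi> h) + t\<^sup>2 * ((norm h)\<^sup>2 / 2)"
        unfolding J_def power2_norm_eq_inner
        by (simp add: scaleR add inner_simps inner_commute power2_eq_square field_simps)
      with Jz m_le[of "z + t *\<^sub>R h"] show ?thesis by linarith
    qed
    from vanish_of_parabola_nonneg[OF this] show ?thesis by (simp add: inner_commute)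
  qed
  with that show thesis by blast
qed

text \<open>\<open>adjoint\<close> is chosen by Hilbert choice, so it has its defining property as
  soon as some adjoint exists; the Riesz vectors of the functionals
  \<open>\<lambda>x. K x \<bullet> y\<close> form one.\<close>

lemma adjoint_works_Hilbert:
  fixes K :: "'a::{real_inner, complete_space} \<Rightarrow> 'b::real_inner"
  assumes K: "bounded_linear K"
  shows "x \<bullet> adjoint K y = K x \<bullet> y"
proof -
  have "\<exists>z. \<forall>x. K x \<bullet> y = x \<bullet> z" for y
    using riesz_representation[OF bounded_linear_inner_left_comp[OF K, of y]] by metis
  then have "\<forall>y. \<exists>z. \<forall>x. K x \<bullet> y = x \<bullet> z" by blast
  from choice[OF this] have "\<exists>K'. \<forall>x y. K x \<bullet> y = x \<bullet> K' y" by blast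
  from someI_ex[OF this] have "\<forall>x y. K x \<bullet> y = x \<bullet> adjoint K y"
    unfolding adjoint_def .
  then show ?thesis by simp
qed

section \<open>Extended-valued convex functions: proximal points and gradients\<close>

lemma proper_finite:
  assumes "proper g" "x \<in> edom g"
  shows "\<bar>g x\<bar> \<noteq> \<infinity>"
  using assms by (auto simp: proper_def edom_def)

text \<open>The passage from \<open>ereal\<close> to real arithmetic. Properness makes
  \<open>g\<close> finite on its domain, so the convexity inequality has a real upper bound; this
  also shows that the domain is convex.\<close>

lemma econvex_imp_convex_on:
  assumes g: "proper g" "econvex g"
  shows "convex_on (edom g) (\<lambda>x. real_of_ereal (g x))"
proof -
  have *: "g ((1 - t) *\<^sub>R x + t *\<^sub>R y)
      \<le> ereal ((1 - t) * real_of_ereal (g x) + t * real_of_ereal (g y))"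
    if "x \<in> edom g" "y \<in> edom g" "0 < t" "t < 1" for x y t
  proof -
    have "g ((1 - t) *\<^sub>R x + t *\<^sub>R y) \<le> ereal (1 - t) * g x + ereal t * g y"
      using g(2) that by (simp add: econvex_def)
    then show ?thesis
      using proper_finite[OF g(1) that(1)] proper_finite[OF g(1) that(2)]
      by (cases "g x"; cases "g y") auto
  qed
  have dom: "(1 - t) *\<^sub>R x + t *\<^sub>R y \<in> edom g"
    if "x \<in> edom g" "y \<in> edom g" "0 < t" "t < 1" for x y t
    using *[OF that] by (auto simp: edom_def)
  have "convex (edom g)"
  proof (rule convexI)
    fix x y :: 'a and a b :: real
    assume "x \<in> edom g" "y \<in> edom g" "0 \<le> a" "0 \<le> b" "a + b = 1"
    then show "a *\<^sub>R x + b *\<^sub>R y \<in> edom g"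
      using dom[of x y b] by (cases "b = 0"; cases "b = 1") (auto simp: eq_diff_eq[symmetric])
  qed
  moreover have "real_of_ereal (g ((1 - t) *\<^sub>R x + t *\<^sub>R y))
      \<le> (1 - t) * real_of_ereal (g x) + t * real_of_ereal (g y)"
    if "0 < t" "t < 1" "x \<in> edom g" "y \<in> edom g" for x y t
    using *[OF that(3,4,1,2)] proper_finite[OF g(1) dom[OF that(3,4,1,2)]]
    by (cases "g ((1 - t) *\<^sub>R x + t *\<^sub>R y)") auto
  ultimately show ?thesis
    by (intro convex_onI)
qed

text \<open>Divide by \<open>t\<close> and let \<open>t\<close> tend to 0 from the right. This is
  the first-order condition at a minimum that is tested along a segment only.\<close>

lemma linear_part_nonneg:
  fixes a b :: real
  assumes "\<And>t. 0 < t \<Longrightarrow> t < 1 \<Longrightarrow> t * a + t\<^sup>2 * b \<ge> 0"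
  shows "a \<ge> 0"
proof -
  have "((\<lambda>t. a + t * b) \<longlongrightarrow> a + 0 * b) (at_right 0)"
    by (intro tendsto_intros)
  moreover have "\<forall>\<^sub>F t in at_right 0. a + t * b \<ge> 0"
    using eventually_at_right_real[OF zero_less_one]
  proof eventually_elim
    case (elim t)
    then have "t * (a + t * b) \<ge> 0"
      using assms[of t] by (simp add: algebra_simps power2_eq_square)
    with elim show ?case by (simp add: zero_le_mult_iff)
  qed
  ultimately show ?thesis
    using tendsto_lowerbound[of "\<lambda>t. a + t * b" "a + 0 * b" "at_right 0" 0] by simp
qed

lemma prox_in_edom:
  assumes g: "proper g" and z: "is_prox \<tau> g p z"
  shows "z \<in> edom g"
proof -
  obtain x where x: "x \<in> edom g" using g by (auto simp: proper_def)
  then have "g x + ereal (1 / (2 * \<tau>) * (norm (x - p))\<^sup>2) < \<infinity>"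
    by (auto simp: edom_def)
  moreover have "\<not> g x + ereal (1 / (2 * \<tau>) * (norm (x - p))\<^sup>2)
      < g z + ereal (1 / (2 * \<tau>) * (norm (z - p))\<^sup>2)"
    using z by (simp add: is_prox_def is_arg_min_def)
  ultimately show ?thesis by (auto simp: edom_def)
qed

text \<open>First-order optimality: \<open>(p - z) / \<tau>\<close> acts as a subgradient of
  \<open>g\<close> at \<open>z\<close>. Comparing \<open>z\<close> with points on the segment
  towards \<open>x\<close>, convexity bounds \<open>g\<close> there and the quadratic term leaves
  its linear part in \<open>t\<close>.\<close>

lemma prox_subgradient:
  assumes \<tau>: "\<tau> > 0" and g: "proper g" "econvex g" and z: "is_prox \<tau> g p z" and x: "x \<in> edom g"
  shows "real_of_ereal (g z) + (p - z) \<bullet> (x - z) / \<tau> \<le> real_of_ereal (g x)"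
proof -
  let ?g = "\<lambda>x. real_of_ereal (g x)"
  note cvx = econvex_imp_convex_on[OF g]
  have zd: "z \<in> edom g" using prox_in_edom[OF g(1) z] .
  have "t * (?g x - ?g z - (p - z) \<bullet> (x - z) / \<tau>) + t\<^sup>2 * ((norm (x - z))\<^sup>2 / (2 * \<tau>)) \<ge> 0"
    if t: "0 < t" "t < 1" for t
  proof -
    define y where "y = (1 - t) *\<^sub>R z + t *\<^sub>R x"
    have yd: "y \<in> edom g"
      using convex_on_imp_convex[OF cvx] zd x t unfolding y_def by (auto intro: convexD)
    have "g z + ereal (1 / (2 * \<tau>) * (norm (z - p))\<^sup>2) \<le> g y + ereal (1 / (2 * \<tau>) * (norm (y - p))\<^sup>2)"
      using z by (auto simp: is_prox_def is_arg_min_def not_less)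
    then have "?g z + 1 / (2 * \<tau>) * (norm (z - p))\<^sup>2 \<le> ?g y + 1 / (2 * \<tau>) * (norm (y - p))\<^sup>2"
      using proper_finite[OF g(1) zd] proper_finite[OF g(1) yd] by (cases "g z"; cases "g y") auto
    moreover have "?g y \<le> (1 - t) * ?g z + t * ?g x"
      unfolding y_def using convex_onD[OF cvx, of t z x] t zd x by auto
    moreover have "(norm (y - p))\<^sup>2 = (norm (z - p))\<^sup>2 - 2 * t * ((p - z) \<bullet> (x - z)) + t\<^sup>2 * (norm (x - z))\<^sup>2"
      unfolding y_def power2_norm_eq_inner
      by (simp add: inner_simps inner_commute power2_eq_square algebra_simps)
    ultimately have "0 \<le> t * (?g x - ?g z)
        + 1 / (2 * \<tau>) * (t\<^sup>2 * (norm (x - z))\<^sup>2 - 2 * t * ((p - z) \<bullet> (x - z)))"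
      by (simp add: algebra_simps)
    then show ?thesis
      using \<tau> by (simp add: field_simps)
  qed
  from linear_part_nonneg[OF this] show ?thesis by simp
qed

lemma dom_gradient_subset_interior: "dom_gradient g \<subseteq> interior (edom g)"
proof
  fix x
  assume "x \<in> dom_gradient g"
  then have "\<forall>\<^sub>F z in nhds x. z \<in> edom g"
    by (auto simp: dom_gradient_def has_gradient_def edom_def elim: eventually_mono)
  then show "x \<in> interior (edom g)"
    by (auto simp: eventually_nhds intro: interiorI)
qed

lemma has_gradient_gradient:
  "x \<in> dom_gradient g \<Longrightarrow> has_gradient g x (gradient g x)"
  by (auto simp: dom_gradient_def gradient_eq)

text \<open>By convexity the difference quotients along the segment from \<open>y\<close> to
  \<open>x\<close> are at most \<open>g x - g y\<close>, and they tend to the directional derivative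
  at \<open>y\<close>. The endpoint \<open>x\<close> may lie on the boundary of the domain.\<close>

lemma gradient_inequality:
  assumes g: "proper g" "econvex g" and y: "y \<in> dom_gradient g" and x: "x \<in> edom g"
  shows "real_of_ereal (g y) + gradient g y \<bullet> (x - y) \<le> real_of_ereal (g x)"
proof -
  let ?g = "\<lambda>x. real_of_ereal (g x)"
  have yd: "y \<in> edom g"
    using y dom_gradient_subset_interior interior_subset by blast
  note cvx = econvex_imp_convex_on[OF g]
  have D: "(?g has_derivative (\<lambda>h. h \<bullet> gradient g y)) (at (y + 0 *\<^sub>R (x - y)))"
    using has_gradient_gradient[OF y] by (simp add: has_gradient_def gderiv_def)
  have "((\<lambda>t. y + t *\<^sub>R (x - y)) has_derivative (\<lambda>t. t *\<^sub>R (x - y))) (at 0)"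
    by (auto intro!: derivative_eq_intros)
  from has_derivative_compose[OF this D]
  have "((\<lambda>t. ?g (y + t *\<^sub>R (x - y))) has_real_derivative gradient g y \<bullet> (x - y)) (at 0)"
    by (simp add: has_field_derivative_def mult_commute_abs inner_commute)
  then have "(\<lambda>t. (?g (y + t *\<^sub>R (x - y)) - ?g y) / t) \<midarrow>0\<rightarrow> gradient g y \<bullet> (x - y)"
    by (simp add: DERIV_def)
  then have "((\<lambda>t. (?g (y + t *\<^sub>R (x - y)) - ?g y) / t) \<longlongrightarrow> gradient g y \<bullet> (x - y)) (at_right 0)"
    by (rule tendsto_mono[rotated]) (simp add: at_le)
  moreover have "\<forall>\<^sub>F t in at_right 0. (?g (y + t *\<^sub>R (x - y)) - ?g y) / t \<le> ?g x - ?g y"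
    using eventually_at_right_real[OF zero_less_one]
  proof eventually_elim
    case (elim t)
    have "y + t *\<^sub>R (x - y) = (1 - t) *\<^sub>R y + t *\<^sub>R x"
      by (simp add: algebra_simps)
    then have "?g (y + t *\<^sub>R (x - y)) \<le> (1 - t) * ?g y + t * ?g x"
      using convex_onD[OF cvx, of t y x] elim yd x by auto
    with elim show ?case by (simp add: field_simps)
  qed
  ultimately have "gradient g y \<bullet> (x - y) \<le> ?g x - ?g y"
    by (intro tendsto_upperbound) auto
  then show ?thesis by simp
qed

section \<open>Bregman distances and smoothness up to the boundary\<close>

lemma bregman_real:
  assumes "\<bar>g x\<bar> \<noteq> \<infinity>" "\<bar>g y\<bar> \<noteq> \<infinity>"
  shows "bregman g \<xi> x y = ereal (real_of_ereal (g x) - real_of_ereal (g y) - \<xi> \<bullet> (x - y))"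
  using assms by (cases "g x"; cases "g y") (auto simp: bregman_def)

lemma L_smooth_real:
  assumes g: "proper g" "L_smooth L g"
    and x: "x \<in> interior (edom g)" and y: "y \<in> interior (edom g)"
  shows "real_of_ereal (g x) - real_of_ereal (g y) - gradient g y \<bullet> (x - y)
    \<le> L / 2 * (norm (x - y))\<^sup>2"
proof -
  have "x \<in> edom g" "y \<in> edom g"
    using subsetD[OF interior_subset] x y by auto
  then have "\<bar>g x\<bar> \<noteq> \<infinity>" "\<bar>g y\<bar> \<noteq> \<infinity>"
    by (auto dest!: proper_finite[OF g(1)])
  moreover have "bregman_grad g x y \<le> ereal (L / 2 * (norm (x - y))\<^sup>2)"
    using g(2) x y by (simp add: L_smooth_def)
  ultimately show ?thesis
    by (simp add: bregman_grad_def bregman_real)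
qed

text \<open>The map \<open>y \<mapsto> (1 - t) x + t y\<close> sends \<open>interior S\<close> to an
  open subset of \<open>S\<close> containing the point in question.\<close>

lemma interior_convex_combination:
  fixes S :: "'a::real_normed_vector set"
  assumes S: "convex S" and c: "c \<in> interior S" and x: "x \<in> S" and t: "0 < t" "t \<le> 1"
  shows "(1 - t) *\<^sub>R x + t *\<^sub>R c \<in> interior S"
proof -
  have "(\<lambda>y. (1 - t) *\<^sub>R x + t *\<^sub>R y) ` interior S \<subseteq> S"
    using S x t interior_subset[of S] by (auto intro!: convexD)
  moreover have "open ((\<lambda>y. (1 - t) *\<^sub>R x + t *\<^sub>R y) ` interior S)"
    using t by (intro open_affinity) auto
  ultimately show ?thesis
    using c by (intro interiorI) auto
qed

text \<open>\<open>L_smooth\<close> compares interior points only, while the solution is merely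
  known to lie in the domain. The estimate holds on the open segment from \<open>x\<close> towards
  \<open>c\<close> and survives \<open>t \<rightarrow> 0\<close>; \<open>radial\<close> stands in
  for lower semicontinuity along that segment, which convexity alone does not give at a boundary
  point.\<close>

lemma L_smooth_up_to_boundary:
  assumes g: "proper g" "econvex g" "L_smooth L g"
    and c: "c \<in> interior (edom g)" and x: "x \<in> edom g" and y: "y \<in> interior (edom g)"
    and radial: "\<And>t. 0 < t \<Longrightarrow> t < 1 \<Longrightarrow>
      real_of_ereal (g x) - t * r \<le> real_of_ereal (g ((1 - t) *\<^sub>R x + t *\<^sub>R c))"
  shows "real_of_ereal (g x) - real_of_ereal (g y) - gradient g y \<bullet> (x - y)
    \<le> L / 2 * (norm (x - y))\<^sup>2"
proof -
  let ?g = "\<lambda>x. real_of_ereal (g x)"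
  let ?x = "\<lambda>t. (1 - t) *\<^sub>R x + t *\<^sub>R c"
  have cvx: "convex (edom g)"
    using econvex_imp_convex_on[OF g(1,2)] by (rule convex_on_imp_convex)
  have "((\<lambda>t. ?g x - t * r - ?g y - gradient g y \<bullet> (?x t - y))
      \<longlongrightarrow> ?g x - 0 * r - ?g y - gradient g y \<bullet> (?x 0 - y)) (at_right 0)"
    by (intro tendsto_intros)
  moreover have "((\<lambda>t. L / 2 * (norm (?x t - y))\<^sup>2) \<longlongrightarrow> L / 2 * (norm (?x 0 - y))\<^sup>2) (at_right 0)"
    by (intro tendsto_intros)
  moreover have "\<forall>\<^sub>F t in at_right 0.
      ?g x - t * r - ?g y - gradient g y \<bullet> (?x t - y) \<le> L / 2 * (norm (?x t - y))\<^sup>2"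
    using eventually_at_right_real[OF zero_less_one]
  proof eventually_elim
    case (elim t)
    then have t: "0 < t" "t < 1" by auto
    then have "?x t \<in> interior (edom g)"
      by (intro interior_convex_combination[OF cvx c x]) auto
    from L_smooth_real[OF g(1,3) this y] radial[OF t] show ?case by linarith
  qed
  ultimately have "?g x - 0 * r - ?g y - gradient g y \<bullet> (?x 0 - y) \<le> L / 2 * (norm (?x 0 - y))\<^sup>2"
    using tendsto_le trivial_limit_at_right_real by blast
  then show ?thesis by simp
qed

section \<open>Fenchel conjugates and Jensen's inequality\<close>

text \<open>Any point of the domain of \<open>H\<close> yields a finite affine minorant of the
  conjugate.\<close>

lemma proper_fenchel_conjugate:
  assumes "proper H" "fenchel_conjugate H v < \<infinity>"
  shows "proper (fenchel_conjugate H)"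
proof -
  obtain x where x: "x \<in> edom H" using assms(1) by (auto simp: proper_def)
  have "fenchel_conjugate H w \<noteq> -\<infinity>" for w
  proof -
    have "ereal (w \<bullet> x) - H x \<le> fenchel_conjugate H w"
      unfolding fenchel_conjugate_def by (rule SUP_upper) simp
    moreover have "ereal (w \<bullet> x) - H x \<noteq> -\<infinity>"
      using proper_finite[OF assms(1) x] by (cases "H x") auto
    ultimately show ?thesis by auto
  qed
  with assms(2) show ?thesis by (auto simp: proper_def edom_def)
qed

text \<open>The conjugate is a supremum of affine functions; points with
  \<open>H x = \<infinity>\<close> contribute only \<open>-\<infinity>\<close>.\<close>

lemma econvex_fenchel_conjugate:
  assumes H: "proper H"
  shows "econvex (fenchel_conjugate H)"
  unfolding econvex_def
proof (intro allI impI)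
  fix v w and t :: real
  assume t: "0 < t \<and> t < 1"
  let ?F = "fenchel_conjugate H"
  have upper: "ereal (w \<bullet> x) - H x \<le> ?F w" for w x
    unfolding fenchel_conjugate_def by (rule SUP_upper) simp
  show "?F ((1 - t) *\<^sub>R v + t *\<^sub>R w) \<le> ereal (1 - t) * ?F v + ereal t * ?F w"
    unfolding fenchel_conjugate_def[of H "(1 - t) *\<^sub>R v + t *\<^sub>R w"]
  proof (rule SUP_least)
    fix x
    show "ereal (((1 - t) *\<^sub>R v + t *\<^sub>R w) \<bullet> x) - H x \<le> ereal (1 - t) * ?F v + ereal t * ?F w"
    proof (cases "H x")
      case (real h)
      have "ereal (((1 - t) *\<^sub>R v + t *\<^sub>R w) \<bullet> x) - H x
          = ereal (1 - t) * (ereal (v \<bullet> x) - H x) + ereal t * (ereal (w \<bullet> x) - H x)"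
        by (simp add: real inner_simps algebra_simps)
      also have "\<dots> \<le> ereal (1 - t) * ?F v + ereal t * ?F w"
        using t upper by (intro add_mono ereal_mult_left_mono) auto
      finally show ?thesis .
    qed (use H in \<open>auto simp: proper_def\<close>)
  qed
qed

text \<open>The conjugate of the indicator of \<open>{f}\<close> is the linear function
  \<open>w \<bullet> f\<close>, whose only subgradient is \<open>f\<close>. Testing the subgradient
  inequality at \<open>v + (\<zeta> - f)\<close> shows this.\<close>

lemma subdifferential_conjugate_singleton:
  assumes "\<zeta> \<in> subdifferential (fenchel_conjugate (convex_indicator {f})) v"
  shows "\<zeta> = f"
proof -
  have conj: "fenchel_conjugate (convex_indicator {f}) w = ereal (w \<bullet> f)" for w
    unfolding fenchel_conjugate_def
    by (rule antisym; intro SUP_least SUP_upper2[of f]) (auto simp: convex_indicator_def)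
  have "v \<bullet> f + \<zeta> \<bullet> (v + (\<zeta> - f) - v) \<le> (v + (\<zeta> - f)) \<bullet> f"
    using assms unfolding subdifferential_def conj plus_ereal.simps ereal_less_eq by blast
  then have "(\<zeta> - f) \<bullet> (\<zeta> - f) \<le> 0"
    by (simp add: inner_simps inner_commute)
  then show ?thesis by (simp add: power2_norm_eq_inner[symmetric])
qed

lemma ergodic_mean_jensen:
  assumes f: "convex_on S f" and n: "n \<ge> 1" and x: "\<And>k. k \<in> {1..n} \<Longrightarrow> x k \<in> S"
  shows "ergodic_mean x n \<in> S" "f (ergodic_mean x n) \<le> (1 / real n) * (\<Sum>k=1..n. f (x k))"
proof -
  have mean: "ergodic_mean x n = (\<Sum>k=1..n. (1 / real n) *\<^sub>R x k)"
    by (simp add: ergodic_mean_def scaleR_sum_right)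
  show "ergodic_mean x n \<in> S"
    unfolding mean using n x convex_on_imp_convex[OF f] by (intro convex_sum) auto
  have "f (ergodic_mean x n) \<le> (\<Sum>k=1..n. (1 / real n) * f (x k))"
    unfolding mean using n x f by (intro convex_on_sum[where C = S]) auto
  then show "f (ergodic_mean x n) \<le> (1 / real n) * (\<Sum>k=1..n. f (x k))"
    by (simp add: sum_distrib_left)
qed

section \<open>The Bregman distance of \<open>B\<close>\<close>

text \<open>This is \<open>D_B((x, y), (u, v))\<close> written out in the reals: each quadratic term
  and the bilinear term is evaluated at the differences, and \<open>G\<close> enters through minus
  its own Bregman distance.\<close>

definition condat_vu_distance ::
  "real \<Rightarrow> real \<Rightarrow> ('a::real_inner \<Rightarrow> 'b::real_inner) \<Rightarrow> ('a \<Rightarrow> ereal) \<Rightarrow>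
   'a \<Rightarrow> 'b \<Rightarrow> 'a \<Rightarrow> 'b \<Rightarrow> real" where
  "condat_vu_distance \<tau> \<sigma> K G x y u v =
     (norm (x - u))\<^sup>2 / (2 * \<tau>) + (norm (y - v))\<^sup>2 / (2 * \<sigma>) - (y - v) \<bullet> K (x - u)
     - (real_of_ereal (G x) - real_of_ereal (G u) - gradient G u \<bullet> (x - u))"

text \<open>Near \<open>(u, v)\<close> the function \<open>G \<circ> fst\<close> is finite, so
  \<open>B\<close> agrees there with a real expression that can be differentiated term by term; the
  adjoint moves the coupling term onto the first component.\<close>

lemma has_gradient_condat_vu_B:
  fixes K :: "'a::{real_inner, complete_space} \<Rightarrow> 'b::real_inner"
  assumes K: "bounded_linear K" and G: "has_gradient G u D"
  shows "has_gradient (condat_vu_B \<tau> \<sigma> K G) (u, v)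
    ((1 / \<tau>) *\<^sub>R u - adjoint K v - D, (1 / \<sigma>) *\<^sub>R v - K u)"
proof -
  let ?B = "\<lambda>(x, y). 1 / (2 * \<tau>) * (norm x)\<^sup>2 + 1 / (2 * \<sigma>) * (norm y)\<^sup>2 - y \<bullet> K x - real_of_ereal (G x)"
  have "(fst \<longlongrightarrow> fst (u, v)) (nhds (u, v))"
    by (intro tendsto_fst filterlim_ident)
  moreover have "\<forall>\<^sub>F x in nhds (fst (u, v)). \<bar>G x\<bar> \<noteq> \<infinity>"
    using G by (simp add: has_gradient_def)
  ultimately have "\<forall>\<^sub>F w in nhds (u, v). \<bar>G (fst w)\<bar> \<noteq> \<infinity>"
    by (rule eventually_compose_filterlim[rotated])
  then have fin: "\<forall>\<^sub>F w in nhds (u, v). condat_vu_B \<tau> \<sigma> K G w = ereal (?B w)"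
  proof eventually_elim
    case (elim w)
    then show ?case
      by (cases w; cases "G (fst w)") (auto simp: condat_vu_B_def)
  qed
  have dG: "((\<lambda>w. real_of_ereal (G (fst w))) has_derivative (\<lambda>h. fst h \<bullet> D)) (at (u, v))"
    using G by (intro has_derivative_compose[OF has_derivative_fst[OF has_derivative_ident]])
      (simp add: has_gradient_def gderiv_def)
  have dK: "((\<lambda>w. K (fst w)) has_derivative (\<lambda>h. K (fst h))) (at (u, v))"
    by (intro bounded_linear.has_derivative[OF K] has_derivative_fst has_derivative_ident)
  have "(?B has_derivative (\<lambda>h. h \<bullet> ((1 / \<tau>) *\<^sub>R u - adjoint K v - D, (1 / \<sigma>) *\<^sub>R v - K u))) (at (u, v))"
    unfolding case_prod_beta power2_norm_eq_inner
    by (rule derivative_eq_intros dG dK refl)+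
      (auto simp: fun_eq_iff inner_simps inner_commute adjoint_works_Hilbert[OF K] field_simps)
  then have "((\<lambda>w. real_of_ereal (condat_vu_B \<tau> \<sigma> K G w)) has_derivative
      (\<lambda>h. h \<bullet> ((1 / \<tau>) *\<^sub>R u - adjoint K v - D, (1 / \<sigma>) *\<^sub>R v - K u))) (at (u, v))"
  proof (rule has_derivative_transform_eventually)
    show "\<forall>\<^sub>F w in at (u, v). ?B w = real_of_ereal (condat_vu_B \<tau> \<sigma> K G w)"
      by (rule eventually_mono[OF filter_leD[OF at_within_le_nhds fin]]) simp
    show "?B (u, v) = real_of_ereal (condat_vu_B \<tau> \<sigma> K G (u, v))"
      using eventually_nhds_x_imp_x[OF fin] by simp
  qed simp
  moreover have "\<forall>\<^sub>F w in nhds (u, v). \<bar>condat_vu_B \<tau> \<sigma> K G w\<bar> \<noteq> \<infinity>"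
    using fin by eventually_elim simp
  ultimately show ?thesis
    by (simp add: has_gradient_def gderiv_def)
qed

lemma bregman_condat_vu_B:
  fixes K :: "'a::{real_inner, complete_space} \<Rightarrow> 'b::real_inner"
  assumes K: "bounded_linear K" and u: "u \<in> dom_gradient G" and x: "\<bar>G x\<bar> \<noteq> \<infinity>"
  shows "bregman_grad (condat_vu_B \<tau> \<sigma> K G) (x, y) (u, v)
    = ereal (condat_vu_distance \<tau> \<sigma> K G x y u v)"
proof -
  interpret K: bounded_linear K by (rule K)
  have D: "gradient (condat_vu_B \<tau> \<sigma> K G) (u, v)
      = ((1 / \<tau>) *\<^sub>R u - adjoint K v - gradient G u, (1 / \<sigma>) *\<^sub>R v - K u)"
    by (intro gradient_eq has_gradient_condat_vu_B K has_gradient_gradient u)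
  have "\<bar>G u\<bar> \<noteq> \<infinity>"
    using has_gradient_gradient[OF u] eventually_nhds_x_imp_x[of "\<lambda>z. \<bar>G z\<bar> \<noteq> \<infinity>"]
    by (simp add: has_gradient_def)
  then obtain a b where ab: "G x = ereal a" "G u = ereal b"
    using x by auto
  show ?thesis
    unfolding bregman_grad_def bregman_def D
    unfolding condat_vu_distance_def condat_vu_B_def power2_norm_eq_inner
    by (simp add: ab inner_simps K.diff inner_commute[of "adjoint K v"]
        adjoint_works_Hilbert[OF K])
      (simp add: inner_commute diff_divide_distrib add_divide_distrib algebra_simps)
qed

text \<open>The three-point identity of Bregman distances: the right-hand side is the pairing of
  \<open>\<nabla>B(u', v') - \<nabla>B(u, v)\<close> with \<open>(x - u', y - v')\<close>. The
  values of \<open>G\<close> cancel.\<close>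

lemma condat_vu_distance_three_point:
  fixes K :: "'a::real_inner \<Rightarrow> 'b::real_inner"
  assumes K: "bounded_linear K" and adj: "\<And>x y. x \<bullet> adjoint K y = K x \<bullet> y"
  shows "condat_vu_distance \<tau> \<sigma> K G x y u v
      - condat_vu_distance \<tau> \<sigma> K G x y u' v' - condat_vu_distance \<tau> \<sigma> K G u' v' u v
    = ((1 / \<tau>) *\<^sub>R (u' - u) - (adjoint K v' - adjoint K v) - (gradient G u' - gradient G u)) \<bullet> (x - u')
      + ((1 / \<sigma>) *\<^sub>R (v' - v) - K (u' - u)) \<bullet> (y - v')"
proof -
  interpret K: bounded_linear K by (rule K)
  have adj': "adjoint K y \<bullet> x = K x \<bullet> y" for x y
    by (metis adj inner_commute)
  show ?thesis
    unfolding condat_vu_distance_def power2_norm_eq_inner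
    by (simp add: inner_simps K.diff adj adj' inner_commute diff_divide_distrib add_divide_distrib
        algebra_simps)
qed

lemma condat_vu_distance_lower_bound:
  assumes K: "bounded_linear K"
    and steps: "\<tau> > 0" "\<sigma> > 0" "\<tau> * (\<sigma> * (onorm K)\<^sup>2 + L) < 1"
    and smooth: "real_of_ereal (G x) - real_of_ereal (G u) - gradient G u \<bullet> (x - u)
      \<le> L / 2 * (norm (x - u))\<^sup>2"
  shows "(1 / \<sigma> - (onorm K)\<^sup>2 / (1 / \<tau> - L)) / 2 * (norm (y - v))\<^sup>2
    \<le> condat_vu_distance \<tau> \<sigma> K G x y u v"
proof -
  define a where "a = 1 / \<tau> - L"
  define p where "p = norm (x - u)"
  define q where "q = norm (y - v)"
  define \<kappa> where "\<kappa> = onorm K"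
  have "a > \<sigma> * \<kappa>\<^sup>2"
    using steps by (simp add: a_def \<kappa>_def field_simps)
  then have a: "a > 0"
    using steps(2) by (smt (verit) mult_nonneg_nonneg zero_le_power2)
  have "(y - v) \<bullet> K (x - u) \<le> q * (\<kappa> * p)"
    using norm_cauchy_schwarz[of "y - v" "K (x - u)"]
      mult_left_mono[OF onorm[OF K, of "x - u"], of q]
    by (simp add: p_def q_def \<kappa>_def)
  then have "a / 2 * p\<^sup>2 + q\<^sup>2 / (2 * \<sigma>) - q * (\<kappa> * p) \<le> condat_vu_distance \<tau> \<sigma> K G x y u v"
    using smooth by (simp add: condat_vu_distance_def p_def[symmetric] q_def[symmetric] a_def field_simps)
  moreover have "a / 2 * p\<^sup>2 + q\<^sup>2 / (2 * \<sigma>) - q * (\<kappa> * p)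
      = (1 / \<sigma> - \<kappa>\<^sup>2 / a) / 2 * q\<^sup>2 + a / 2 * (p - \<kappa> * q / a)\<^sup>2"
    using a steps(2) by (simp add: field_simps power2_eq_square)
  moreover have "a / 2 * (p - \<kappa> * q / a)\<^sup>2 \<ge> 0"
    using a by simp
  ultimately show ?thesis
    unfolding a_def[symmetric] \<kappa>_def[symmetric] q_def[symmetric] by linarith
qed

section \<open>Real recursions\<close>

lemma sum_affine:
  "(\<Sum>k=1..n. real k * c + s) = real n * (real n + 1) / 2 * c + real n * s"
  by (induction n) (simp_all add: field_simps)

text \<open>Strong induction. The sum contains \<open>r n\<close> itself, so
  \<open>\<mu> * r n\<close> is moved to the left; if \<open>r n\<close> exceeded
  \<open>w = n \<mu> + sqrt S\<close>, monotonicity of \<open>t (t - \<mu>)\<close> beyond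
  \<open>w \<ge> \<mu>\<close> would contradict the bound on the earlier terms.\<close>

lemma perturbed_quadratic_recursion:
  fixes r :: "nat \<Rightarrow> real"
  assumes S: "S \<ge> 0" and \<mu>: "\<mu> \<ge> 0"
    and rec: "\<And>n. (r n)\<^sup>2 \<le> S + \<mu> * (\<Sum>k=1..n. r k)"
  shows "r n \<le> real n * \<mu> + sqrt S"
proof (induction n rule: less_induct)
  case (less n)
  define s where "s = sqrt S"
  have s: "s \<ge> 0" "s\<^sup>2 = S" using S by (auto simp: s_def)
  show ?case
  proof (cases n)
    case 0
    then show ?thesis using rec[of 0] by (simp add: real_le_rsqrt)
  next
    case (Suc m)
    show ?thesis
    proof (rule ccontr)
      assume "\<not> ?thesis"
      then have r: "r n > real n * \<mu> + s" by (simp add: s_def)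
      have "(\<Sum>k=1..m. r k) \<le> (\<Sum>k=1..m. real k * \<mu> + s)"
        using less Suc by (intro sum_mono) (auto simp: s_def)
      also have "\<dots> = real m * (real m + 1) / 2 * \<mu> + real m * s"
        by (rule sum_affine)
      finally have "\<mu> * (\<Sum>k=1..m. r k) \<le> \<mu> * (real m * (real m + 1) / 2 * \<mu> + real m * s)"
        using \<mu> by (rule mult_left_mono)
      then have up: "(r n)\<^sup>2 - \<mu> * r n \<le> s\<^sup>2 + \<mu>\<^sup>2 * (real m * (real m + 1)) / 2 + \<mu> * real m * s"
        using rec[of n] by (simp add: Suc s(2)[symmetric] algebra_simps power2_eq_square)
      define w where "w = real n * \<mu> + s"
      have w: "w \<ge> \<mu>" "w \<ge> 0"
        using s \<mu> by (auto simp: w_def Suc algebra_simps)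
      have "(r n - w) * (r n + (w - \<mu>)) > 0"
        using r w by (intro mult_pos_pos) (auto simp: w_def)
      then have "(r n)\<^sup>2 - \<mu> * r n > w * (w - \<mu>)"
        by (simp add: algebra_simps power2_eq_square)
      also have "w * (w - \<mu>) = s\<^sup>2 + \<mu>\<^sup>2 * (real m * (real m + 1)) + \<mu> * s * (2 * real m + 1)"
        by (simp add: w_def Suc algebra_simps power2_eq_square)
      finally have "\<mu>\<^sup>2 * (real m * (real m + 1)) / 2 + \<mu> * s * (real m + 1) < 0"
        using up by (simp add: field_simps)
      moreover have "\<mu>\<^sup>2 * (real m * (real m + 1)) / 2 + \<mu> * s * (real m + 1) \<ge> 0"
        using s \<mu> by simp
      ultimately show False by linarith
    qed
  qed
qed

text \<open>Telescoping controls the errors by the sum of the \<open>r k\<close>. Coercivity turns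
  the same estimate into a quadratic recursion with \<open>\<mu> = 2 \<beta> / \<nu>\<close> and
  \<open>S = 2 a 0 / \<nu>\<close>, and the resulting linear growth of \<open>r\<close> is fed back
  into the telescoped sum.\<close>

lemma sum_bound_of_perturbed_descent:
  fixes a e r :: "nat \<Rightarrow> real"
  assumes \<beta>: "\<beta> \<ge> 0" and \<nu>: "\<nu> > 0"
    and e: "\<And>k. e (Suc k) \<ge> 0"
    and descent: "\<And>k. e (Suc k) + a (Suc k) \<le> a k + \<beta> * r (Suc k)"
    and coercive: "\<And>k. \<nu> / 2 * (r k)\<^sup>2 \<le> a k"
  shows "(\<Sum>k=1..n. e k) \<le> a 0 + \<beta>\<^sup>2 / \<nu> * real n * (real n + 1) + \<beta> * real n * sqrt (2 * a 0 / \<nu>)"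
proof -
  have tele: "(\<Sum>k=1..n. e k) + a n \<le> a 0 + \<beta> * (\<Sum>k=1..n. r k)" for n
  proof (induction n)
    case (Suc n)
    with descent[of n] show ?case by (simp add: algebra_simps)
  qed simp
  have nonneg: "(\<Sum>k=1..n. e k) \<ge> 0" for n
  proof (rule sum_nonneg)
    fix k assume "k \<in> {1..n}"
    then show "e k \<ge> 0" using e[of "k - 1"] by simp
  qed
  have a: "a k \<ge> 0" for k
    using coercive[of k] \<nu> by (smt (verit) divide_nonneg_nonneg mult_nonneg_nonneg zero_le_power2)
  have "(r n)\<^sup>2 \<le> 2 * a 0 / \<nu> + 2 * \<beta> / \<nu> * (\<Sum>k=1..n. r k)" for n
  proof -
    have "\<nu> / 2 * (r n)\<^sup>2 \<le> a 0 + \<beta> * (\<Sum>k=1..n. r k)"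
      using coercive[of n] tele[of n] nonneg[of n] by linarith
    with \<nu> show ?thesis by (simp add: field_simps)
  qed
  then have r: "r n \<le> real n * (2 * \<beta> / \<nu>) + sqrt (2 * a 0 / \<nu>)" for n
    using a[of 0] \<beta> \<nu> by (intro perturbed_quadratic_recursion) auto
  have "(\<Sum>k=1..n. r k) \<le> (\<Sum>k=1..n. real k * (2 * \<beta> / \<nu>) + sqrt (2 * a 0 / \<nu>))"
    using r by (intro sum_mono) auto
  also have "\<dots> = real n * (real n + 1) / 2 * (2 * \<beta> / \<nu>) + real n * sqrt (2 * a 0 / \<nu>)"
    by (rule sum_affine)
  finally have "\<beta> * (\<Sum>k=1..n. r k)
      \<le> \<beta> * (real n * (real n + 1) / 2 * (2 * \<beta> / \<nu>) + real n * sqrt (2 * a 0 / \<nu>))"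
    using \<beta> by (rule mult_left_mono)
  also have "\<dots> = \<beta>\<^sup>2 / \<nu> * real n * (real n + 1) + \<beta> * real n * sqrt (2 * a 0 / \<nu>)"
    by (simp add: add_divide_distrib algebra_simps power2_eq_square)
  finally show ?thesis using tele[of n] a[of n] by linarith
qed

section \<open>Ergodic means and one step of the iteration\<close>

lemma econvex_add:
  fixes g h :: "'a::real_vector \<Rightarrow> ereal"
  assumes g: "proper g" "econvex g" and h: "proper h" "econvex h"
  shows "econvex (\<lambda>x. g x + h x)"
  unfolding econvex_def
proof (intro allI impI)
  fix x y :: 'a and t :: real
  assume t: "0 < t \<and> t < 1"
  let ?z = "(1 - t) *\<^sub>R x + t *\<^sub>R y"
  have "g ?z + h ?z \<le> (ereal (1 - t) * g x + ereal t * g y) + (ereal (1 - t) * h x + ereal t * h y)"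
    using g(2) h(2) t by (intro add_mono) (auto simp: econvex_def)
  also have "\<dots> = ereal (1 - t) * (g x + h x) + ereal t * (g y + h y)"
    using g(1) h(1) t by (cases "g x"; cases "g y"; cases "h x"; cases "h y")
      (auto simp: proper_def algebra_simps)
  finally show "g ?z + h ?z \<le> ereal (1 - t) * (g x + h x) + ereal t * (g y + h y)" .
qed

text \<open>For fixed \<open>\<xi>\<close> and \<open>y\<close> the Bregman distance is convex in
  its first argument: Jensen's inequality handles \<open>g\<close>, and the affine part commutes
  with averaging.\<close>

lemma bregman_ergodic_mean:
  assumes g: "proper g" "econvex g" and n: "n \<ge> 1"
    and x: "\<And>k. k \<in> {1..n} \<Longrightarrow> x k \<in> edom g" and y: "y \<in> edom g"
  shows "bregman g \<xi> (ergodic_mean x n) y \<le> ereal ((1 / real n) *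
    (\<Sum>k=1..n. real_of_ereal (g (x k)) - real_of_ereal (g y) - \<xi> \<bullet> (x k - y)))"
proof -
  note jensen = ergodic_mean_jensen[where x = x, OF econvex_imp_convex_on[OF g] n x]
  have "\<xi> \<bullet> (ergodic_mean x n - y) = (1 / real n) * (\<Sum>k=1..n. \<xi> \<bullet> (x k - y))"
    using n by (simp add: ergodic_mean_def inner_diff_right inner_sum_right sum_subtractf field_simps)
  moreover have "real_of_ereal (g y) = (1 / real n) * (\<Sum>k=1..n. real_of_ereal (g y))"
    using n by simp
  moreover have "bregman g \<xi> (ergodic_mean x n) y = ereal (real_of_ereal (g (ergodic_mean x n))
      - real_of_ereal (g y) - \<xi> \<bullet> (ergodic_mean x n - y))"
    using proper_finite[OF g(1)] jensen(1) y by (intro bregman_real) auto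
  ultimately show ?thesis
    using jensen(2) by (simp add: sum_subtractf right_diff_distrib)
qed

lemma subgradient_real:
  assumes "\<xi> \<in> subdifferential g y" "\<bar>g x\<bar> \<noteq> \<infinity>"
  shows "real_of_ereal (g y) + \<xi> \<bullet> (x - y) \<le> real_of_ereal (g x)"
proof -
  have "\<bar>g y\<bar> \<noteq> \<infinity>" "g y + ereal (\<xi> \<bullet> (x - y)) \<le> g x"
    using assms(1) by (auto simp: subdifferential_def)
  with assms(2) show ?thesis by (cases "g x"; cases "g y") auto
qed

text \<open>The left-hand side is the saddle gap of the Lagrangian
  \<open>h + g + \<langle>y, K x\<rangle> - \<phi>\<close> between \<open>(u', y)\<close> and
  \<open>(x, v')\<close>. It is bounded by the two prox inequalities and the gradient inequality for
  \<open>G\<close> at \<open>u'\<close>; the extrapolation \<open>2 u' - u\<close> makes the dual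
  residual the second component of \<open>\<nabla>B(u, v) - \<nabla>B(u', v')\<close> plus
  \<open>K u'\<close>.\<close>

lemma condat_vu_one_step:
  fixes K :: "'a::{real_inner, complete_space} \<Rightarrow> 'b::real_inner"
    and G R :: "'a \<Rightarrow> ereal" and F :: "'b \<Rightarrow> ereal"
  defines "h \<equiv> \<lambda>x. real_of_ereal (R x)" and "g \<equiv> \<lambda>x. real_of_ereal (G x)"
    and "\<phi> \<equiv> \<lambda>y. real_of_ereal (F y)"
  assumes K: "bounded_linear K" and \<tau>: "\<tau> > 0" and \<sigma>: "\<sigma> > 0"
    and R: "proper R" "econvex R" and G: "proper G" "econvex G" and F: "proper F" "econvex F"
    and u': "u' \<in> dom_gradient G"
    and primal: "is_prox \<tau> R (u - \<tau> *\<^sub>R (adjoint K v + gradient G u)) u'"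
    and dual: "is_prox \<sigma> F (v + \<sigma> *\<^sub>R K (2 *\<^sub>R u' - u)) v'"
    and x: "x \<in> edom R" "x \<in> edom G" and y: "y \<in> edom F"
  shows "h u' + g u' + \<phi> v' + y \<bullet> K u' - (h x + g x + \<phi> y + v' \<bullet> K x)
    \<le> condat_vu_distance \<tau> \<sigma> K G x y u v - condat_vu_distance \<tau> \<sigma> K G x y u' v'
      - condat_vu_distance \<tau> \<sigma> K G u' v' u v"
proof -
  interpret K: bounded_linear K by (rule K)
  note adj = adjoint_works_Hilbert[OF K]
  have adj': "adjoint K y \<bullet> x = K x \<bullet> y" for x y
    by (metis adj inner_commute)
  have "h u' + ((1 / \<tau>) *\<^sub>R (u - u') - adjoint K v - gradient G u) \<bullet> (x - u') \<le> h x"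
    using prox_subgradient[OF \<tau> R primal x(1)] \<tau>
    by (simp add: h_def inner_diff_left inner_add_left diff_divide_distrib add_divide_distrib)
  moreover have "\<phi> v' + ((1 / \<sigma>) *\<^sub>R (v - v') + K (2 *\<^sub>R u' - u)) \<bullet> (y - v') \<le> \<phi> y"
    using prox_subgradient[OF \<sigma> F dual y] \<sigma>
    by (simp add: \<phi>_def inner_diff_left inner_add_left diff_divide_distrib add_divide_distrib)
  moreover have "g u' + gradient G u' \<bullet> (x - u') \<le> g x"
    using gradient_inequality[OF G u' x(2)] by (simp add: g_def)
  ultimately show ?thesis
    using condat_vu_distance_three_point[OF K adj, of \<tau> \<sigma> G x y u v u' v']
    by (simp add: inner_simps K.diff K.add K.scaleR adj adj' inner_commute diff_divide_distrib
        add_divide_distrib algebra_simps)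
qed

section \<open>The error estimate\<close>

theorem theorem3p1:
  fixes K :: "'a::{real_inner, complete_space} \<Rightarrow> 'b::{real_inner, complete_space}"
    and f f\<delta> :: 'b
    and \<delta> L \<tau> \<sigma> C :: real
    and R G :: "'a \<Rightarrow> ereal"
    and H\<delta> :: "'b \<Rightarrow> ereal"
    and u_dag :: 'a and v_dag :: 'b
    and u :: "nat \<Rightarrow> 'a" and v :: "nat \<Rightarrow> 'b"
    and \<zeta>\<delta> \<zeta> :: 'b
  defines "Hf \<equiv> convex_indicator {f}"
    and "DB \<equiv> real_of_ereal (bregman_grad (condat_vu_B \<tau> \<sigma> K G) (u_dag, v_dag) (u 0, v 0))"
  assumes K: "bounded_linear K"
    and noise: "norm (f - f\<delta>) \<le> \<delta>"
    and H\<delta>: "proper H\<delta>" "econvex H\<delta>" "lsc H\<delta>"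
    and R: "proper R" "econvex R" "lsc R"
    and G: "proper G" "econvex G" "frechet_differentiable G" "L_smooth L G"
    and qualification: "\<exists>u_bar. u_bar \<in> edom (Hf \<circ> K) \<inter> edom R \<inter> edom G \<and>
                               isCont (\<lambda>x. R x + G x) u_bar"
    and feasible: "K u_dag = f"
    and finite_u_dag: "\<bar>R u_dag\<bar> \<noteq> \<infinity>" "\<bar>G u_dag\<bar> \<noteq> \<infinity>"
    and optimal: "\<And>x. K x = f \<Longrightarrow> R u_dag + G u_dag \<le> R x + G x"
    and source: "- adjoint K v_dag \<in> subdifferential (\<lambda>x. R x + G x) u_dag"
    and steps: "\<tau> > 0" "\<sigma> > 0" "\<tau> * (\<sigma> * (onorm K)\<^sup>2 + L) < 1"
    and iteration: "condat_vu \<tau> \<sigma> K R G H\<delta> u v"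
    and C: "C > 0"
    and \<zeta>\<delta>: "\<zeta>\<delta> \<in> subdifferential (fenchel_conjugate H\<delta>) v_dag"
    and \<zeta>: "\<zeta> \<in> subdifferential (fenchel_conjugate Hf) v_dag"
    and bound: "\<forall>k. (\<zeta>\<delta> - \<zeta>) \<bullet> (v_dag - v k) \<le> C * \<delta> * norm (v_dag - v k)"
  shows "\<exists>\<nu>>0. \<forall>n\<ge>1.
           bregman (\<lambda>x. R x + G x) (- adjoint K v_dag) (ergodic_mean u n) u_dag
         + bregman (fenchel_conjugate H\<delta>) \<zeta>\<delta> (ergodic_mean v n) v_dag
         \<le> ereal (1 / real n * DB + C\<^sup>2 / \<nu> * \<delta>\<^sup>2 * (real n + 1) + C * \<delta> * sqrt (2 * DB / \<nu>))"
proof -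
  interpret K: bounded_linear K by (rule K)
  define F where "F = fenchel_conjugate H\<delta>"
  define P where "P = (\<lambda>x. R x + G x)"
  define h where "h = (\<lambda>x. real_of_ereal (R x))"
  define g where "g = (\<lambda>x. real_of_ereal (G x))"
  define \<phi> where "\<phi> = (\<lambda>y. real_of_ereal (F y))"
  define a where "a k = condat_vu_distance \<tau> \<sigma> K G u_dag v_dag (u k) (v k)" for k
  define r where "r k = norm (v_dag - v k)" for k
  \<comment> \<open>The sum of the two Bregman distances of the conclusion, taken at the
    \<open>k\<close>-th iterate and in real form.\<close>
  define e where "e k = (h (u k) + g (u k) - (h u_dag + g u_dag) - - adjoint K v_dag \<bullet> (u k - u_dag))
    + (\<phi> (v k) - \<phi> v_dag - \<zeta>\<delta> \<bullet> (v k - v_dag))" for k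
  define \<nu> where "\<nu> = 1 / \<sigma> - (onorm K)\<^sup>2 / (1 / \<tau> - L)"
  note adj = adjoint_works_Hilbert[OF K]
  have adj': "adjoint K y \<bullet> x = K x \<bullet> y" for x y
    by (metis adj inner_commute)

  have fin_F: "\<bar>F v_dag\<bar> \<noteq> \<infinity>"
    using \<zeta>\<delta> by (simp add: subdifferential_def F_def)
  then have F: "proper F" "econvex F"
    using proper_fenchel_conjugate[OF H\<delta>(1), of v_dag] econvex_fenchel_conjugate[OF H\<delta>(1)]
    by (auto simp: F_def)
  have dag: "u_dag \<in> edom R" "u_dag \<in> edom G" "v_dag \<in> edom F"
    using finite_u_dag fin_F by (auto simp: edom_def)
  have finR: "\<bar>R x\<bar> \<noteq> \<infinity>" if "x \<in> edom R" for x using proper_finite[OF R(1) that] .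
  have finG: "\<bar>G x\<bar> \<noteq> \<infinity>" if "x \<in> edom G" for x using proper_finite[OF G(1) that] .
  have P_edom: "x \<in> edom P" and P_real: "real_of_ereal (P x) = h x + g x"
    if "x \<in> edom R" "x \<in> edom G" for x
    using finR[OF that(1)] finG[OF that(2)]
    by (cases "R x"; cases "G x"; simp add: P_def h_def g_def edom_def)+
  have P: "proper P" "econvex P"
    using econvex_add[OF R(1,2) G(1,2)] P_edom[OF dag(1,2)] R(1) G(1)
    by (auto simp: P_def proper_def)

  have uG: "u k \<in> dom_gradient G" for k
    using iteration by (simp add: condat_vu_def)
  then have uG_int: "u k \<in> interior (edom G)" for k
    using dom_gradient_subset_interior by blast
  then have uG_dom: "u k \<in> edom G" for k
    using interior_subset by blast
  have primal: "is_prox \<tau> R (u k - \<tau> *\<^sub>R (adjoint K (v k) + gradient G (u k))) (u (Suc k))" for k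
    using iteration by (simp add: condat_vu_def)
  have dual: "is_prox \<sigma> F (v k + \<sigma> *\<^sub>R K (2 *\<^sub>R u (Suc k) - u k)) (v (Suc k))" for k
    using iteration by (simp add: condat_vu_def F_def)
  have uR: "u (Suc k) \<in> edom R" for k
    by (rule prox_in_edom[OF R(1) primal])
  have vF: "v (Suc k) \<in> edom F" for k
    by (rule prox_in_edom[OF F(1) dual])

  obtain u_bar where bar: "u_bar \<in> edom R" "u_bar \<in> edom G" "K u_bar = f"
      and cont: "isCont P u_bar"
    using qualification unfolding Hf_def P_def
    by (auto simp: edom_def convex_indicator_def split: if_splits)
  \<comment> \<open>Continuity with a finite value keeps \<open>R + G\<close> below
    \<open>\<infinity>\<close> near \<open>u_bar\<close>; as \<open>R\<close> never equals
    \<open>-\<infinity>\<close>, \<open>G\<close> is below \<open>\<infinity>\<close> there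
    too.\<close>
  have bar_int: "u_bar \<in> interior (edom G)"
  proof -
    have "P u_bar < \<infinity>" using P_edom[OF bar(1,2)] by (simp add: edom_def)
    with cont have "\<forall>\<^sub>F x in at u_bar. P x < \<infinity>"
      unfolding isCont_def by (rule order_tendstoD)
    then have "\<forall>\<^sub>F x in nhds u_bar. P x < \<infinity>"
      using \<open>P u_bar < \<infinity>\<close> by (auto simp: eventually_at_filter elim: eventually_mono)
    then have "\<forall>\<^sub>F x in nhds u_bar. x \<in> edom G"
      using R(1) by (auto simp: P_def edom_def proper_def elim: eventually_mono)
    then show ?thesis by (auto simp: eventually_nhds intro: interiorI)
  qed

  \<comment> \<open>\<open>u_dag\<close> may lie on the boundary of the domain of \<open>G\<close>, where a convex function can jump up.
    A jump would let the feasible segment towards \<open>u_bar\<close> decrease \<open>R + G\<close> below its minimum.\<close>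
  have radial: "g u_dag - t * (h u_bar - h u_dag) \<le> g ((1 - t) *\<^sub>R u_dag + t *\<^sub>R u_bar)"
    if t: "0 < t" "t < 1" for t
  proof -
    let ?x = "(1 - t) *\<^sub>R u_dag + t *\<^sub>R u_bar"
    note cvxR = econvex_imp_convex_on[OF R(1,2)]
    have xR: "?x \<in> edom R"
      using convex_on_imp_convex[OF cvxR] dag(1) bar(1) t by (auto intro: convexD)
    have xG: "?x \<in> edom G"
      using convex_on_imp_convex[OF econvex_imp_convex_on[OF G(1,2)]] dag(2) bar(2) t
      by (auto intro: convexD)
    have "K ?x = f"
      by (simp add: K.add K.scaleR feasible bar(3) scaleR_left_distrib[symmetric])
    from optimal[OF this] have "h u_dag + g u_dag \<le> h ?x + g ?x"
      using finR[OF xR] finG[OF xG] finR[OF dag(1)] finG[OF dag(2)]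
      by (cases "R u_dag"; cases "G u_dag"; cases "R ?x"; cases "G ?x") (auto simp: h_def g_def)
    moreover have "h ?x \<le> (1 - t) * h u_dag + t * h u_bar"
      unfolding h_def using convex_onD[OF cvxR, of t u_dag u_bar] dag(1) bar(1) t by auto
    ultimately show ?thesis by (simp add: algebra_simps)
  qed

  have coercive: "\<nu> / 2 * (r k)\<^sup>2 \<le> a k" for k
    unfolding \<nu>_def r_def a_def
    by (intro condat_vu_distance_lower_bound K steps
        L_smooth_up_to_boundary[OF G(1,2,4) bar_int dag(2) uG_int radial[unfolded g_def]])
  have \<nu>: "\<nu> > 0"
  proof -
    define b where "b = 1 / \<tau> - L"
    have "\<sigma> * (onorm K)\<^sup>2 < b"
      using steps by (simp add: b_def field_simps)
    moreover from this have "0 < b"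
      using steps(2) by (smt (verit) mult_nonneg_nonneg zero_le_power2)
    ultimately show ?thesis
      using steps(2) unfolding \<nu>_def b_def[symmetric] by (simp add: field_simps)
  qed
  \<comment> \<open>Both points are iterates and hence interior, so the smoothness inequality
    applies directly. This is the term that the descent estimate discards.\<close>
  have step_nonneg: "condat_vu_distance \<tau> \<sigma> K G (u (Suc k)) (v (Suc k)) (u k) (v k) \<ge> 0" for k
  proof -
    have "0 \<le> \<nu> / 2 * (norm (v (Suc k) - v k))\<^sup>2" using \<nu> by simp
    also have "\<dots> \<le> condat_vu_distance \<tau> \<sigma> K G (u (Suc k)) (v (Suc k)) (u k) (v k)"
      unfolding \<nu>_def
      by (intro condat_vu_distance_lower_bound K steps L_smooth_real G uG_int)
    finally show ?thesis .
  qed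

  have \<zeta>_eq: "\<zeta> = f"
    using \<zeta> unfolding Hf_def by (rule subdifferential_conjugate_singleton)
  \<comment> \<open>With \<open>\<zeta> = f = K u_dag\<close>, \<open>e (Suc k)\<close> is exactly
    the saddle gap plus \<open>(\<zeta>\<delta> - \<zeta>) \<bullet> (v_dag - v (Suc k))\<close>,
    which the assumed bound controls.\<close>
  have descent: "e (Suc k) + a (Suc k) \<le> a k + (C * \<delta>) * r (Suc k)" for k
  proof -
    note condat_vu_one_step[OF K steps(1,2) R(1,2) G(1,2) F uG primal dual dag, of k]
    moreover have "(\<zeta>\<delta> - f) \<bullet> (v_dag - v (Suc k)) \<le> C * \<delta> * norm (v_dag - v (Suc k))"
      using bound by (simp add: \<zeta>_eq)
    moreover have "adjoint K v_dag \<bullet> (u (Suc k) - u_dag) = v_dag \<bullet> K (u (Suc k)) - f \<bullet> v_dag"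
      by (simp add: inner_diff_right adj' feasible inner_commute[of v_dag])
    ultimately show ?thesis
      using step_nonneg[of k]
      by (simp add: e_def a_def r_def h_def g_def \<phi>_def feasible inner_diff_left inner_diff_right
          inner_commute[of _ f])
  qed
  have e: "e (Suc k) \<ge> 0" for k
  proof -
    have "h u_dag + g u_dag + - adjoint K v_dag \<bullet> (u (Suc k) - u_dag) \<le> h (u (Suc k)) + g (u (Suc k))"
      using subgradient_real[OF source[folded P_def], of "u (Suc k)"]
        proper_finite[OF P(1) P_edom[OF uR uG_dom]] P_real[OF uR uG_dom] P_real[OF dag(1,2)]
      by simp
    moreover have "\<phi> v_dag + \<zeta>\<delta> \<bullet> (v (Suc k) - v_dag) \<le> \<phi> (v (Suc k))"
      unfolding \<phi>_def
      using subgradient_real[OF \<zeta>\<delta>[folded F_def] proper_finite[OF F(1) vF]] .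
    ultimately show ?thesis by (simp add: e_def)
  qed

  \<comment> \<open>The distance is a finite \<open>ereal\<close> because \<open>G\<close> is
    differentiable at \<open>u 0\<close> and finite at \<open>u_dag\<close>, so
    \<open>real_of_ereal\<close> returns its true value.\<close>
  have DB: "DB = a 0"
    by (simp add: DB_def a_def bregman_condat_vu_B[OF K uG finite_u_dag(2)])
  have "0 \<le> \<delta>"
    using noise norm_ge_zero order_trans by blast
  with C have \<beta>: "C * \<delta> \<ge> 0" by simp
  note sum_bound = sum_bound_of_perturbed_descent[where a = a and e = e and r = r, OF \<beta> \<nu> e descent coercive, folded DB]

  have "bregman P (- adjoint K v_dag) (ergodic_mean u n) u_dag
      + bregman F \<zeta>\<delta> (ergodic_mean v n) v_dag
      \<le> ereal (1 / real n * DB + C\<^sup>2 / \<nu> * \<delta>\<^sup>2 * (real n + 1) + C * \<delta> * sqrt (2 * DB / \<nu>))"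
    if n: "n \<ge> 1" for n
  proof -
    \<comment> \<open>Averages start at index 1: only the outputs of a prox step are known to lie in
      the domains of \<open>R\<close> and \<open>F\<close>.\<close>
    have iterates: "u k \<in> edom R" "v k \<in> edom F" if "k \<in> {1..n}" for k
      using uR[of "k - 1"] vF[of "k - 1"] that by auto
    have "bregman P (- adjoint K v_dag) (ergodic_mean u n) u_dag \<le> ereal ((1 / real n) *
        (\<Sum>k=1..n. real_of_ereal (P (u k)) - real_of_ereal (P u_dag) - - adjoint K v_dag \<bullet> (u k - u_dag)))"
      by (intro bregman_ergodic_mean P n P_edom iterates uG_dom dag)
    moreover have "bregman F \<zeta>\<delta> (ergodic_mean v n) v_dag \<le> ereal ((1 / real n) *
        (\<Sum>k=1..n. \<phi> (v k) - \<phi> v_dag - \<zeta>\<delta> \<bullet> (v k - v_dag)))"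
      unfolding \<phi>_def by (intro bregman_ergodic_mean F n iterates dag)
    ultimately have "bregman P (- adjoint K v_dag) (ergodic_mean u n) u_dag
        + bregman F \<zeta>\<delta> (ergodic_mean v n) v_dag
      \<le> ereal ((1 / real n) * (\<Sum>k=1..n. real_of_ereal (P (u k)) - real_of_ereal (P u_dag)
            - - adjoint K v_dag \<bullet> (u k - u_dag)))
        + ereal ((1 / real n) * (\<Sum>k=1..n. \<phi> (v k) - \<phi> v_dag - \<zeta>\<delta> \<bullet> (v k - v_dag)))"
      by (rule add_mono)
    also have "\<dots> = ereal ((1 / real n) * (\<Sum>k=1..n. e k))"
    proof -
      have "(\<Sum>k=1..n. e k) = (\<Sum>k=1..n. (real_of_ereal (P (u k)) - real_of_ereal (P u_dag)
            - - adjoint K v_dag \<bullet> (u k - u_dag)) + (\<phi> (v k) - \<phi> v_dag - \<zeta>\<delta> \<bullet> (v k - v_dag)))"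
        unfolding e_def
        by (intro sum.cong refl) (simp add: P_real iterates uG_dom dag)
      then show ?thesis
        by (simp only: sum.distrib distrib_left plus_ereal.simps)
    qed
    also have "\<dots> \<le> ereal ((1 / real n) * (DB + (C * \<delta>)\<^sup>2 / \<nu> * real n * (real n + 1)
        + C * \<delta> * real n * sqrt (2 * DB / \<nu>)))"
      unfolding ereal_less_eq by (intro mult_left_mono sum_bound) simp
    also have "(1 / real n) * (DB + (C * \<delta>)\<^sup>2 / \<nu> * real n * (real n + 1)
        + C * \<delta> * real n * sqrt (2 * DB / \<nu>))
        = 1 / real n * DB + C\<^sup>2 / \<nu> * \<delta>\<^sup>2 * (real n + 1) + C * \<delta> * sqrt (2 * DB / \<nu>)"
      using n \<nu> by (simp add: distrib_left power_mult_distrib)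
    finally show ?thesis .
  qed
  with \<nu> show ?thesis
    unfolding P_def F_def by blast
qed

end
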